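(* For every positive integer $d$, there exists a Danzer set in $\mathbb{R}^d$ of growth rate $T^d\log T$; that is, there exists $Y\subseteq\mathbb{R}^d$ which intersects every convex subset of $\mathbb{R}^d$ of volume $1$ and satisfies $\#(Y\cap B(0,T))=O(T^d\log T)$ as $T\to\infty$.
   Context: $B(0,T)$ is the Euclidean ball of radius $T$ centered at the origin in $\mathbb{R}^d$. A set $Y\subseteq\mathbb{R}^d$ is a Danzer set if it intersects every convex subset of $\mathbb{R}^d$ of volume $1$. *)

theory Defs
  imports "HOL-Analysis.Analysis" "HOL-Library.Landau_Symbols"
begin

text \<open>
  Volume is Lebesgue measure. Every convex set is Lebesgue measurable but need not be Borel
  measurable, hence \<^const>\<open>lebesgue\<close> rather than \<^const>\<open>lborel\<close>.
\<close>

definition danzer_set :: "'a::euclidean_space set \<Rightarrow> bool" where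
  "danzer_set Y \<longleftrightarrow> (\<forall>K. convex K \<and> emeasure lebesgue K = 1 \<longrightarrow> Y \<inter> K \<noteq> {})"

text \<open>
  Finiteness is required separately because \<^const>\<open>card\<close> is 0 on infinite sets.
\<close>

definition has_growth_rate :: "'a::euclidean_space set \<Rightarrow> (real \<Rightarrow> real) \<Rightarrow> bool" where
  "has_growth_rate Y f \<longleftrightarrow>
     (\<forall>T. finite (Y \<inter> ball 0 T)) \<and>
     (\<lambda>T. real (card (Y \<inter> ball 0 T))) \<in> O[at_top](f)"

end

theory Submission
  imports Defs
begin

text \<open>
  At each dyadic scale \<open>2 ^ k\<close> one picks a net \<open>N k\<close> of \<open>O(2 ^ (k * d) * (k + 1))\<close> points meeting every convex
  set of volume at least \<open>c\<close> in the ball of radius \<open>2 ^ k\<close>; the Danzer set consists of the part of each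
  \<open>N k\<close> at distance roughly \<open>2 ^ k\<close> from the origin. Shrinking a convex set by the factor \<open>1 / 4\<close>
  towards a point almost farthest from the origin moves it into such an annulus, so this part suffices.

  The net is a greedy hitting set: polynomially many (in \<open>2 ^ k\<close>) sets of volume at least \<open>c'\<close> in the
  ball are hit by \<open>O(2 ^ (k * d) * (k + 1))\<close> points. The sets are the parallelepipeds spanned by points of a
  fine cubic grid. That a convex set \<open>K\<close> contains a large one follows by maximizing the
  volume over the grid points in \<open>K\<close>: by Cramer's rule the doubled maximizer contains all of these
  grid points, hence all of \<open>K\<close> except a thin part near its boundary.
\<close>

subsection \<open>Greedy hitting sets\<close>

text \<open>Double counting: the number of sets of \<open>U\<close> containing a point, integrated
  over \<open>X\<close>, is the sum of the measures. Hence a point where this number is largest lies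
  in at least the average number of sets.\<close>

lemma exists_point_in_many_sets:
  fixes U :: "'a set set"
  assumes X: "X \<in> fmeasurable M" and U: "finite U"
    and S: "\<And>S. S \<in> U \<Longrightarrow> S \<in> sets M \<and> S \<subseteq> X \<and> c \<le> measure M S"
  shows "\<exists>x. c * card U \<le> measure M X * card {S \<in> U. x \<in> S}"
proof -
  define f where "f x = card {S \<in> U. x \<in> S}" for x
  have "\<forall>x. f x \<le> card U"
    unfolding f_def by (auto intro!: card_mono U)
  then obtain x where x: "\<And>y. f y \<le> f x"
    using ex_has_greatest_nat[of "\<lambda>_. True" _ f "Suc (card U)"] by (auto simp: less_Suc_eq_le)
  have f_eq: "(\<Sum>S\<in>U. indicator S y) = real (f y)" for y
    unfolding f_def using U
    by (simp add: indicator_def sum.If_cases Int_def)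
  have fin: "S \<in> fmeasurable M" if "S \<in> U" for S
    using S[OF that] X by (meson fmeasurableI2)
  have "c * card U \<le> (\<Sum>S\<in>U. measure M S)"
    using sum_bounded_below[of U c "measure M"] S by (simp add: mult.commute)
  also have "\<dots> = (\<integral>y. (\<Sum>S\<in>U. indicator S y) \<partial>M)"
    using fin by (subst Bochner_Integration.integral_sum)
      (auto simp: fmeasurable_def intro!: sum.cong Int_absorb2 [symmetric] arg_cong[where f="measure M"] dest: sets.sets_into_space)
  also have "\<dots> \<le> (\<integral>y. real (f x) * indicator X y \<partial>M)"
  proof (rule integral_mono)
    show "integrable M (\<lambda>y. \<Sum>S\<in>U. indicator S y :: real)"
      using fin by (intro Bochner_Integration.integrable_sum) (auto simp: fmeasurable_def)
    show "integrable M (\<lambda>y. real (f x) * indicator X y)"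
      using X by (auto simp: fmeasurable_def)
    show "(\<Sum>S\<in>U. indicator S y) \<le> real (f x) * indicator X y" for y
    proof (cases "y \<in> X")
      case True then show ?thesis using x[of y] by (simp add: f_eq)
    next
      case False
      then have "indicator S y = (0::real)" if "S \<in> U" for S using S[OF that] by (auto simp: indicator_def)
      then show ?thesis using False by (simp add: sum.neutral)
    qed
  qed
  also have "\<dots> = measure M X * f x"
    using X by (simp add: fmeasurable_def sets.Int_space_eq2)
  finally show ?thesis unfolding f_def by blast
qed

text \<open>Each new point is chosen to hit at least the fraction \<open>c / measure M X\<close> of
  the sets not hit so far, so every step multiplies the number of remaining sets by at most one
  minus this fraction.\<close>

lemma greedy_hitting_set:
  fixes F :: "'a set set"
  assumes X: "X \<in> fmeasurable M" and F: "finite F" and c: "0 < c"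
    and S: "\<And>S. S \<in> F \<Longrightarrow> S \<in> sets M \<and> S \<subseteq> X \<and> c \<le> measure M S"
  shows "\<exists>N. finite N \<and> card N \<le> n \<and>
           card {S \<in> F. N \<inter> S = {}} \<le> card F * (1 - c / measure M X) ^ n"
proof (cases "F = {}")
  case True
  then show ?thesis by (auto intro!: exI[of _ "{}"])
next
  case False
  then obtain S0 where "S0 \<in> F" by auto
  \<comment> \<open>A member of \<open>F\<close> forces \<open>c\<close> to be at most the measure
    of \<open>X\<close>, so the factor of the geometric decay is nonnegative and the division is
    genuine.\<close>
  then have cX: "c \<le> measure M X"
    using S[of S0] X measure_mono_fmeasurable[of S0 X M] by force
  then have q: "0 \<le> 1 - c / measure M X" and X0: "0 < measure M X" using c by (auto simp: field_simps)
  show ?thesis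
  proof (induction n)
    case 0
    show ?case by (auto intro!: exI[of _ "{}"])
  next
    case (Suc n)
    then obtain N where N: "finite N" "card N \<le> n"
      "card {S \<in> F. N \<inter> S = {}} \<le> card F * (1 - c / measure M X) ^ n" by blast
    let ?U = "{S \<in> F. N \<inter> S = {}}"
    obtain x where x: "c * card ?U \<le> measure M X * card {S \<in> ?U. x \<in> S}"
      using exists_point_in_many_sets[OF X, of ?U c] F S by auto
    have "?U = {S \<in> F. insert x N \<inter> S = {}} \<union> {S \<in> ?U. x \<in> S}" by auto
    moreover have "card ({S \<in> F. insert x N \<inter> S = {}} \<union> {S \<in> ?U. x \<in> S})
        = card {S \<in> F. insert x N \<inter> S = {}} + card {S \<in> ?U. x \<in> S}"
      using F by (intro card_Un_disjoint) auto
    ultimately have "card ?U = card {S \<in> F. insert x N \<inter> S = {}} + card {S \<in> ?U. x \<in> S}"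
      by argo
    then have "real (card {S \<in> F. insert x N \<inter> S = {}}) = card ?U - real (card {S \<in> ?U. x \<in> S})"
      by linarith
    also have "\<dots> \<le> card ?U - c / measure M X * card ?U"
      using x X0 by (simp add: field_simps)
    also have "\<dots> = (1 - c / measure M X) * card ?U" by (simp add: algebra_simps)
    also have "\<dots> \<le> (1 - c / measure M X) * (card F * (1 - c / measure M X) ^ n)"
      using N(3) q by (rule mult_left_mono)
    finally show ?case
      using N by (intro exI[of _ "insert x N"]) (auto simp: card_insert_if algebra_simps)
  qed
qed

text \<open>After \<open>n > L / q\<close> greedy steps fewer than
  \<open>card F * exp (- L)\<close>, hence fewer than one, of the sets remain. The summand 2 pays
  for rounding up and for the extra step that makes the inequality strict. A bound \<open>L\<close>
  in place of the logarithm itself allows crude estimates of \<open>card F\<close>.\<close>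

lemma small_hitting_set:
  fixes F :: "'a set set"
  assumes X: "X \<in> fmeasurable M" and F: "finite F" and c: "0 < c"
    and S: "\<And>S. S \<in> F \<Longrightarrow> S \<in> sets M \<and> S \<subseteq> X \<and> c \<le> measure M S"
    and L: "ln (card F) \<le> L" "0 \<le> L"
  shows "\<exists>N. finite N \<and> card N \<le> measure M X / c * L + 2 \<and> (\<forall>S\<in>F. N \<inter> S \<noteq> {})"
proof (cases "F = {}")
  case True
  then show ?thesis using c L by (auto intro!: exI[of _ "{}"])
next
  case False
  then obtain S0 where "S0 \<in> F" by auto
  then have cX: "c \<le> measure M X"
    using S[of S0] X measure_mono_fmeasurable[of S0 X M] by force
  define q where "q = c / measure M X"
  have q: "0 < q" "q \<le> 1" using cX c by (auto simp: q_def)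
  define n where "n = nat \<lceil>L / q\<rceil> + 1"
  have n: "L / q < n" "n \<le> L / q + 2"
    using L q unfolding n_def by (auto simp: of_nat_nat) linarith+
  have F0: "0 < real (card F)" using False F by (simp add: card_gt_0_iff)
  obtain N where N: "finite N" "card N \<le> n" "card {S \<in> F. N \<inter> S = {}} \<le> card F * (1 - q) ^ n"
    using greedy_hitting_set[OF X F c S, of n] unfolding q_def by blast
  note N(3)
  also have "card F * (1 - q) ^ n \<le> card F * exp (- q) ^ n"
    using q exp_ge_add_one_self[of "-q"] by (intro mult_left_mono power_mono) auto
  also have "\<dots> = card F * exp (- (q * n))"
    by (simp add: exp_of_nat_mult[symmetric] mult.commute)
  also have "\<dots> < card F * exp (- L)"
    using n(1) q F0 by (simp add: field_simps)
  also have "\<dots> \<le> card F * exp (- ln (card F))" using L(1) F0 by (intro mult_left_mono) auto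
  also have "\<dots> = 1" using F0 by (simp add: exp_minus)
  finally have "card {S \<in> F. N \<inter> S = {}} = 0" by simp
  then have "\<forall>S\<in>F. N \<inter> S \<noteq> {}" using F by auto
  moreover have "real (card N) \<le> measure M X / c * L + 2"
    using N(2) n(2) by (simp add: q_def mult.commute)
  ultimately show ?thesis using N(1) by blast
qed

subsection \<open>Parallelepipeds in convex sets\<close>

text \<open>By convexity a point pushed out of \<open>K\<close> never returns, so the translates of this set by the
  first \<open>J\<close> multiples of the displacement are disjoint.\<close>
lemma measure_non_translatable_part:
  fixes K :: "'a::euclidean_space set"
  assumes K: "convex K" "K \<in> lmeasurable" "K \<subseteq> cball 0 R" and J: "0 < J"
    and e: "norm e \<le> 1"  and R: "0 \<le> R"
  shows "{x \<in> K. x + (R / real J) *\<^sub>R e \<notin> K} \<in> lmeasurable"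
    and "J * measure lebesgue {x \<in> K. x + (R / real J) *\<^sub>R e \<notin> K} \<le> measure lebesgue (cball (0::'a) (2 * R))"
proof -
  define v where "v = (R / real J) *\<^sub>R e"
  define B where "B = {x \<in> K. x + v \<notin> K}"
  have "B = K - (+) (- v) ` K"
    unfolding B_def by (force simp: image_iff)
  then have B: "B \<in> lmeasurable"
    using K(2) measurable_translation[OF K(2), of "-v"] by (metis fmeasurable.Diff)
  then show "{x \<in> K. x + (R / real J) *\<^sub>R e \<notin> K} \<in> lmeasurable"
    unfolding B_def v_def .
  have later: "x + real j *\<^sub>R v \<notin> K" if x: "x \<in> B" and j: "0 < j" for x j
  proof
    assume "x + real j *\<^sub>R v \<in> K"
    \<comment> \<open>The point \<open>x + v\<close> lies on the segment from \<open>x\<close> to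
      \<open>x + j v\<close>, so a return to \<open>K\<close> would contradict convexity.\<close>
    moreover have "x + v = (1 - 1 / real j) *\<^sub>R x + (1 / real j) *\<^sub>R (x + real j *\<^sub>R v)"
      using j by (simp add: algebra_simps)
    ultimately have "x + v \<in> K"
      using convexD_alt[OF K(1), of x "x + real j *\<^sub>R v" "1 / real j"] x j by (simp add: B_def)
    then show False using x by (simp add: B_def)
  qed
  let ?T = "\<lambda>j. (+) (real j *\<^sub>R v) ` B"
  have less: "?T i \<inter> ?T j = {}" if "i < j" for i j
  proof (rule ccontr)
    assume "?T i \<inter> ?T j \<noteq> {}"
    then obtain x y where xy: "x \<in> B" "y \<in> B" "real i *\<^sub>R v + x = real j *\<^sub>R v + y" by auto
    then have "x = y + real (j - i) *\<^sub>R v" using that by (simp add: algebra_simps of_nat_diff)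
    then show False using later[OF xy(2), of "j - i"] xy(1) that by (auto simp: B_def)
  qed
  have "real J * measure lebesgue B = (\<Sum>j<J. measure lebesgue (?T j))"
    by (simp add: measure_translation)
  also have "\<dots> = measure lebesgue (\<Union>j<J. ?T j)"
  proof (rule measure_UNION'[symmetric])
    show "pairwise (\<lambda>i j. disjnt (?T i) (?T j)) {..<J}"
      using less unfolding pairwise_def disjnt_def by (metis inf_commute nat_neq_iff)
  qed (use B in \<open>auto intro: measurable_translation\<close>)
  also have "\<dots> \<le> measure lebesgue (cball (0::'a) (2 * R))"
  proof (rule measure_mono_fmeasurable)
    show "(\<Union>j<J. ?T j) \<subseteq> cball 0 (2 * R)"
    proof clarsimp
      fix j x assume jx: "j < J" "x \<in> B"
      \<comment> \<open>For \<open>j < J\<close> the total displacement is at most \<open>R\<close>,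
        so all translates stay in the ball of radius \<open>2 * R\<close>.\<close>
      have "real j * norm v = (real j / real J) * (R * norm e)" using R by (simp add: v_def)
      also have "\<dots> \<le> 1 * (R * 1)" using jx R e by (intro mult_mono) auto
      finally have "real j * norm v \<le> R" by simp
      moreover have "norm x \<le> R" using jx K(3) by (auto simp: B_def)
      ultimately show "norm (real j *\<^sub>R v + x) \<le> 2 * R"
        using norm_triangle_ineq[of "real j *\<^sub>R v" x] by simp
    qed
    show "(\<Union>j<J. ?T j) \<in> sets lebesgue"
      using measurable_translation[OF B] by (intro sets.finite_UN) auto
  qed auto
  finally show "J * measure lebesgue {x \<in> K. x + (R / real J) *\<^sub>R e \<notin> K} \<le> measure lebesgue (cball (0::'a) (2 * R))"
    by (simp add: B_def v_def)
qed

lemma measure_parallelepiped_ratio: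
  fixes A :: "real^'n^'n"
  defines "d \<equiv> real CARD('n)"
  shows "measure lebesgue ((\<lambda>t. v + A *v t) ` cbox (-1) 1)
       = (2 * d) ^ CARD('n) * measure lebesgue ((\<lambda>t. v + A *v t) ` cbox 0 (vec (1 / d)))"
proof -
  have d: "0 < d" by (simp add: d_def)
  have "cbox (-1) 1 = (\<lambda>t. (2 * d) *\<^sub>R t + (-1)) ` cbox 0 (vec (1 / d) :: real^'n)"
  proof (intro equalityI subsetI)
    fix t :: "real^'n" assume "t \<in> cbox (-1) 1"
    then have "-1 \<le> t $ i" "t $ i \<le> 1" for i by (auto simp: mem_box_cart)
    then have "0 \<le> 1 + t $ i" "t $ i \<le> 1" for i by (smt (verit))+
    then have "(1 / (2 * d)) *\<^sub>R (t + 1) \<in> cbox 0 (vec (1 / d))"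
      using d by (simp add: mem_box_cart field_simps)
    moreover have "t = (2 * d) *\<^sub>R ((1 / (2 * d)) *\<^sub>R (t + 1)) + (-1)" using d by simp
    ultimately show "t \<in> (\<lambda>t. (2 * d) *\<^sub>R t + (-1)) ` cbox 0 (vec (1 / d))" by blast
  next
    fix t :: "real^'n" assume "t \<in> (\<lambda>t. (2 * d) *\<^sub>R t + (-1)) ` cbox 0 (vec (1 / d))"
    then obtain s :: "real^'n" where s: "s \<in> cbox 0 (vec (1 / d))" "t = (2 * d) *\<^sub>R s + (-1)" by blast
    have "0 \<le> d * s $ i" "d * s $ i \<le> 1" for i
      using s(1) d by (auto simp: mem_box_cart field_simps)
    then show "t \<in> cbox (-1) 1" by (simp add: s(2) mem_box_cart)
  qed
  then have "(\<lambda>t. v + A *v t) ` cbox (-1) 1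
      = (\<lambda>x. (2 * d) *\<^sub>R x + (v - (2 * d) *\<^sub>R v - A *v 1)) ` ((\<lambda>t. v + A *v t) ` cbox 0 (vec (1 / d)))"
    by (simp add: image_image matrix_vector_right_distrib matrix_vector_mult_scaleR algebra_simps)
  then show ?thesis
    using d by (simp only: measure_lebesgue_affine) simp
qed

lemma compact_affine_image_cbox_cart:
  fixes A :: "real^'n^'m"
  shows "compact ((\<lambda>t. v + A *v t) ` cbox a b)"
  by (intro compact_continuous_image compact_cbox continuous_on_add continuous_on_const
      linear_continuous_on linear_linear[THEN iffD2] matrix_vector_mul_linear)

text \<open>The columns are the edges at \<open>v\<close> of the simplex with vertices
  \<open>v\<close> and \<open>w j\<close>; up to a factorial, the absolute determinant is the volume
  of that simplex.\<close>

definition edge_matrix :: "real^'n \<Rightarrow> ('n \<Rightarrow> real^'n) \<Rightarrow> real^'n^'n" where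
  "edge_matrix v w = (\<chi> i j. w j $ i - v $ i)"

lemma edge_matrix_mult: "edge_matrix v w *v t = (\<Sum>j\<in>UNIV. t $ j *\<^sub>R (w j - v))"
  by (simp add: vec_eq_iff edge_matrix_def matrix_vector_mult_def mult.commute)

text \<open>Choose the simplex with vertices in \<open>G\<close> of largest volume. By Cramer's rule
  the coordinates of a point of \<open>G\<close> are ratios of determinants of such simplices to the
  maximal one, hence at most 1 in absolute value. The simplex given by \<open>u\<close> and
  \<open>z\<close> ensures that the maximum is nonzero.\<close>

lemma finite_subset_max_simplex_parallelepiped:
  fixes G :: "(real^'n) set"
  assumes G: "finite G" and u: "u \<in> G" "range z \<subseteq> G" "det (edge_matrix u z) \<noteq> 0"
  shows "\<exists>v w. v \<in> G \<and> range w \<subseteq> G \<and>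
           G \<subseteq> (\<lambda>t. v + edge_matrix v w *v t) ` cbox (-1) 1"
proof -
  let ?P = "G \<times> (UNIV \<rightarrow>\<^sub>E G)"
  let ?D = "\<lambda>(v, w). \<bar>det (edge_matrix v w)\<bar>"
  have fin: "finite (?D ` ?P)" using G by (intro finite_imageI finite_cartesian_product finite_PiE) auto
  have uz: "(u, z) \<in> ?P" using u by auto
  obtain v w where vw: "(v, w) \<in> ?P" "?D (v, w) = Max (?D ` ?P)"
    using Max_in[OF fin] uz by (smt (verit) empty_iff imageE imageI old.prod.exhaust)
  have le: "\<bar>det (edge_matrix v' w')\<bar> \<le> \<bar>det (edge_matrix v w)\<bar>" if "v' \<in> G" "range w' \<subseteq> G" for v' w'
    using Max_ge[OF fin, of "?D (v', w')"] vw(2) that by fastforce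
  let ?A = "edge_matrix v w"
  have A0: "det ?A \<noteq> 0" using le[OF u(1,2)] u(3) by auto
  have "x \<in> (\<lambda>t. v + ?A *v t) ` cbox (-1) 1" if x: "x \<in> G" for x
  proof -
    define t where "t = (\<chi> k. det (\<chi> i j. if j = k then (x - v) $ i else ?A $ i $ j) / det ?A)"
    have "?A *v t = x - v" using cramer[OF A0, of t "x - v"] unfolding t_def by blast
    then have "x = v + ?A *v t" by simp
    moreover have "\<bar>t $ k\<bar> \<le> 1" for k
    proof -
      \<comment> \<open>Replacing column \<open>k\<close> by \<open>x - v\<close> amounts to
        exchanging the vertex \<open>w k\<close> for \<open>x\<close>.\<close>
      have "(\<chi> i j. if j = k then (x - v) $ i else ?A $ i $ j) = edge_matrix v (w(k := x))"
        by (simp add: vec_eq_iff edge_matrix_def)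
      then have "\<bar>t $ k\<bar> = \<bar>det (edge_matrix v (w(k := x)))\<bar> / \<bar>det ?A\<bar>"
        by (simp add: t_def)
      also have "\<dots> \<le> 1"
        using le[of v "w(k := x)"] vw(1) x A0 by (auto simp: divide_le_eq_1 PiE_def Pi_def)
      finally show ?thesis .
    qed
    then have "t \<in> cbox (-1) 1" by (simp add: mem_box_cart abs_le_iff minus_le_iff)
    ultimately show ?thesis by blast
  qed
  then show ?thesis using vw(1) by (intro exI[of _ v] exI[of _ w]) auto
qed

lemma mem_convex_average:
  fixes f :: "'n::finite \<Rightarrow> 'a::real_vector"
  assumes "convex K" "\<And>i. f i \<in> K"
  shows "(\<Sum>i\<in>UNIV. (1 / real CARD('n)) *\<^sub>R f i) \<in> K"
  using assms by (intro convex_sum) auto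

text \<open>A point with coordinates \<open>t\<close> is the average over \<open>i\<close> of the
  points at parameter \<open>CARD('n) * t $ i\<close> on the segments from \<open>v\<close> to
  \<open>w i\<close>. The side length of the box keeps these parameters in the unit
  interval.\<close>

lemma parallelepiped_subset_convex:
  fixes K :: "(real^'n) set"
  assumes K: "convex K" "v \<in> K" "range w \<subseteq> K"
  shows "(\<lambda>t. v + edge_matrix v w *v t) ` cbox 0 (vec (1 / real CARD('n))) \<subseteq> K"
proof clarify
  fix t :: "real^'n" assume "t \<in> cbox 0 (vec (1 / real CARD('n)))"
  then have t: "0 \<le> t $ i" "real CARD('n) * t $ i \<le> 1" for i
    by (auto simp: mem_box_cart field_simps)
  let ?f = "\<lambda>i. (1 - real CARD('n) * t $ i) *\<^sub>R v + (real CARD('n) * t $ i) *\<^sub>R w i"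
  have "?f i \<in> K" for i
    using K t[of i] by (intro convexD_alt) auto
  then have "(\<Sum>i\<in>UNIV. (1 / real CARD('n)) *\<^sub>R ?f i) \<in> K"
    by (rule mem_convex_average[OF K(1)])
  also have "(\<Sum>i\<in>UNIV. (1 / real CARD('n)) *\<^sub>R ?f i)
      = (\<Sum>i\<in>(UNIV::'n set). (1 / real CARD('n)) *\<^sub>R v + t $ i *\<^sub>R (w i - v))"
    by (intro sum.cong) (auto simp: algebra_simps)
  also have "\<dots> = v + edge_matrix v w *v t"
    by (simp add: sum.distrib edge_matrix_mult sum_constant_scaleR del: sum_constant)
  finally show "v + edge_matrix v w *v t \<in> K" .
qed

text \<open>The point \<open>y\<close> is the average over \<open>i\<close> of points displaced from
  \<open>x\<close> along a single axis by \<open>CARD('n)\<close> times the difference of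
  coordinates. Each of them lies between the two given points on that axis.\<close>

lemma cube_subset_convex:
  fixes K :: "(real^'n) set"
  assumes K: "convex K" and h: "0 < h"
    and x: "\<And>i. x + h *\<^sub>R axis i 1 \<in> K" "\<And>i. x + h *\<^sub>R (- axis i 1) \<in> K"
    and y: "\<And>i. real CARD('n) * \<bar>y $ i - x $ i\<bar> \<le> h"
  shows "y \<in> K"
proof -
  let ?f = "\<lambda>i. x + (real CARD('n) * (y $ i - x $ i)) *\<^sub>R axis i 1"
  have "?f i \<in> K" for i
  proof -
    define s where "s = (1 + real CARD('n) * (y $ i - x $ i) / h) / 2"
    have "\<bar>real CARD('n) * (y $ i - x $ i)\<bar> \<le> h" using y[of i] by (simp add: abs_mult)
    then have s: "0 \<le> s" "s \<le> 1" using h by (auto simp: s_def field_simps abs_le_iff)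
    have "(1 - s) *\<^sub>R (x + h *\<^sub>R (- axis i 1)) + s *\<^sub>R (x + h *\<^sub>R axis i 1) = x + ((2 * s - 1) * h) *\<^sub>R axis i 1"
      by (simp add: algebra_simps flip: scaleR_add_left)
    also have "(2 * s - 1) * h = real CARD('n) * (y $ i - x $ i)" using h by (simp add: s_def field_simps)
    finally show ?thesis using convexD_alt[OF K x(2)[of i] x(1)[of i] s] by simp
  qed
  then have "(\<Sum>i\<in>UNIV. (1 / real CARD('n)) *\<^sub>R ?f i) \<in> K"
    by (rule mem_convex_average[OF K])
  also have "(\<Sum>i\<in>UNIV. (1 / real CARD('n)) *\<^sub>R ?f i)
      = (\<Sum>i\<in>(UNIV::'n set). (1 / real CARD('n)) *\<^sub>R x + (y $ i - x $ i) *\<^sub>R axis i 1)"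
    by (intro sum.cong) (auto simp: algebra_simps)
  also have "\<dots> = x + (y - x)"
    using basis_expansion[of "y - x"]
    by (simp add: sum.distrib sum_constant_scaleR scalar_mult_eq_scaleR del: sum_constant)
  finally show ?thesis by simp
qed

section \<open>Grid points and the parallelepipeds they span\<close>

definition grid :: "real \<Rightarrow> nat \<Rightarrow> (real^'n) set" where
  "grid \<delta> m = {x. \<forall>i. \<exists>j::int. \<bar>j\<bar> \<le> int m \<and> x $ i = \<delta> * j}"

lemma card_grid: "finite (grid \<delta> m :: (real^'n) set)" "card (grid \<delta> m :: (real^'n) set) \<le> (2 * m + 1) ^ CARD('n)"
proof -
  let ?P = "UNIV \<rightarrow>\<^sub>E {- int m..int m} :: ('n \<Rightarrow> int) set"
  have sub: "(grid \<delta> m :: (real^'n) set) \<subseteq> (\<lambda>f. \<chi> i. \<delta> * f i) ` ?P"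
  proof
    fix x :: "real^'n" assume "x \<in> grid \<delta> m"
    then obtain f where f: "\<And>i. \<bar>f i\<bar> \<le> int m \<and> x $ i = \<delta> * of_int (f i)"
      unfolding grid_def by (auto dest!: choice)
    have "f \<in> ?P"
    proof (rule PiE_I)
      show "f i \<in> {- int m..int m}" for i using f[of i] by (simp add: abs_le_iff) 
    qed auto
    moreover have "x = (\<chi> i. \<delta> * f i)" using f by (simp add: vec_eq_iff)
    ultimately show "x \<in> (\<lambda>f. \<chi> i. \<delta> * f i) ` ?P" by blast
  qed
  have fin: "finite ?P" by (intro finite_PiE) auto
  show "finite (grid \<delta> m :: (real^'n) set)" by (rule finite_subset[OF sub finite_imageI[OF fin]])
  have "card (grid \<delta> m :: (real^'n) set) \<le> card ?P"
    by (rule surj_card_le[OF fin sub])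
  also have "\<dots> = (2 * m + 1) ^ CARD('n)"
    by (subst card_PiE) (auto simp: nat_add_distrib nat_mult_distrib)
  finally show "card (grid \<delta> m :: (real^'n) set) \<le> (2 * m + 1) ^ CARD('n)" .
qed

text \<open>The grid cell around \<open>x\<close> is the convex hull of its corners, and every
  corner is within \<delta> of \<open>x\<close> in each coordinate. This passes from grid points in
  a convex set back to arbitrary points.\<close>

lemma cube_corner_grid_hull:
  fixes x :: "real^'n" and \<delta> :: real
  assumes d: "0 < \<delta>" and S: "convex S"
    and corner: "\<And>y. (\<And>i. \<exists>j::int. y $ i = \<delta> * j) \<Longrightarrow> (\<And>i. \<bar>y $ i - x $ i\<bar> \<le> \<delta>) \<Longrightarrow> y \<in> S"
  shows "x \<in> S"
proof -
  define g :: "real^'n" where "g = (\<chi> i. \<delta> * \<lfloor>x $ i / \<delta>\<rfloor>)"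
  define u where "u = (1 / \<delta>) *\<^sub>R (x - g)"
  have u: "0 \<le> u $ i" "u $ i < 1" for i
  proof -
    have "u $ i = x $ i / \<delta> - \<lfloor>x $ i / \<delta>\<rfloor>" using d by (simp add: u_def g_def field_simps)
    then show "0 \<le> u $ i" "u $ i < 1" by linarith+
  qed
  have x: "x = g + \<delta> *\<^sub>R u" using d by (simp add: u_def)
  let ?V = "{e::real^'n. \<forall>i. e $ i = 0 \<or> e $ i = 1}"
  have "u \<in> cbox 0 1" using u by (simp add: mem_box_cart less_imp_le)
  also have "cbox 0 1 = convex hull ?V"
    unfolding Cart_1 unit_interval_convex_hull
    by (rule arg_cong[where f = "\<lambda>X. convex hull X"]) (simp add: Basis_vec_def inner_axis)
  finally have "u \<in> convex hull ?V" .
  then have "x \<in> (\<lambda>e. g + \<delta> *\<^sub>R e) ` (convex hull ?V)" using x by blast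
  also have "\<dots> = convex hull ((\<lambda>e. g + \<delta> *\<^sub>R e) ` ?V)" by (simp add: convex_hull_affinity)
  also have "\<dots> \<subseteq> S"
  proof (rule hull_minimal)
    show "(\<lambda>e. g + \<delta> *\<^sub>R e) ` ?V \<subseteq> S"
    proof clarify
      fix e :: "real^'n" assume e: "\<forall>i. e $ i = 0 \<or> e $ i = 1"
      show "g + \<delta> *\<^sub>R e \<in> S"
      proof (rule corner)
        fix i
        show "\<exists>j::int. (g + \<delta> *\<^sub>R e) $ i = \<delta> * j"
          using e[rule_format, of i]
          by (auto simp: g_def algebra_simps intro: exI[of _ "\<lfloor>x $ i / \<delta>\<rfloor>"] exI[of _ "\<lfloor>x $ i / \<delta>\<rfloor> + 1"])
        have "\<bar>e $ i - u $ i\<bar> \<le> 1" using e[rule_format, of i] u[of i] by auto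
        then have "\<delta> * \<bar>e $ i - u $ i\<bar> \<le> \<delta>" using d by (simp add: mult_left_le)
        also have "\<delta> * \<bar>e $ i - u $ i\<bar> = \<bar>(g + \<delta> *\<^sub>R e) $ i - x $ i\<bar>"
          using d by (subst x) (simp add: abs_mult flip: right_diff_distrib)
        finally show "\<bar>(g + \<delta> *\<^sub>R e) $ i - x $ i\<bar> \<le> \<delta>" .
      qed
    qed
  qed (rule S)
  finally show ?thesis .
qed

text \<open>Points of \<open>K\<close> that stay in \<open>K\<close> after small steps along all
  axes make up at least half of the volume \<open>c\<close>. Grid cells around them have their
  corners in \<open>K\<close>, so the parallelepiped from a maximal grid simplex in \<open>K\<close>
  covers them. Its smaller copy lies in \<open>K\<close> and loses only the factor
  \<open>(2 * d) ^ d\<close>.\<close>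

lemma convex_contains_grid_parallelepiped:
  fixes K :: "(real^'n) set"
  assumes K: "convex K" "K \<in> lmeasurable" "K \<subseteq> cball 0 R" and R: "0 < R" and J: "0 < J"
    and c: "0 < c" "c \<le> measure lebesgue K"
    and Jc: "4 * CARD('n) * measure lebesgue (cball (0::real^'n) (2 * R)) \<le> c * J"
  defines "G \<equiv> grid (R / (CARD('n) * J)) (CARD('n) * J)"
  shows "\<exists>v w. v \<in> G \<and> range w \<subseteq> G \<and>
           (\<lambda>t. v + edge_matrix v w *v t) ` cbox 0 (vec (1 / real CARD('n))) \<subseteq> K \<and>
           c / (2 ^ (CARD('n) + 1) * real CARD('n) ^ CARD('n)) \<le>
             measure lebesgue ((\<lambda>t. v + edge_matrix v w *v t) ` cbox 0 (vec (1 / real CARD('n))))"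
proof -
  let ?d = "real CARD('n)" and ?\<mu> = "measure lebesgue"
  \<comment> \<open>The step \<open>h\<close> is the displacement along the axes. The mesh \<delta>
    is \<open>h\<close> divided by the dimension, so that cubes of this radius around good points
    lie in \<open>K\<close>.\<close>
  define h where "h = R / J"
  define \<delta> where "\<delta> = R / (CARD('n) * J)"
  have h: "0 < h" and \<delta>: "0 < \<delta>" "?d * \<delta> = h" using R J by (auto simp: h_def \<delta>_def)
  define E :: "(real^'n) set" where "E = range (\<lambda>i. axis i 1) \<union> range (\<lambda>i. - axis i 1)"
  define B where "B e = {x \<in> K. x + h *\<^sub>R e \<notin> K}" for e
  have E: "finite E" "card E \<le> 2 * CARD('n)"
    using card_Un_le[of "range (\<lambda>i::'n. axis i (1::real))" "range (\<lambda>i::'n. - axis i (1::real))"]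
      card_image_le[of UNIV "\<lambda>i::'n. axis i (1::real)"] card_image_le[of UNIV "\<lambda>i::'n. - axis i (1::real)"]
    by (auto simp: E_def)
  have B: "B e \<in> lmeasurable" "J * ?\<mu> (B e) \<le> ?\<mu> (cball (0::real^'n) (2 * R))" if "e \<in> E" for e
    using measure_non_translatable_part[OF K J, of e] that R
    by (auto simp: B_def h_def E_def)
  have "(\<Union>e\<in>E. B e) \<in> lmeasurable" using B E by (intro fmeasurable.finite_UN) auto
  have "J * ?\<mu> (\<Union>e\<in>E. B e) \<le> J * (\<Sum>e\<in>E. ?\<mu> (B e))"
    using B E by (intro mult_left_mono measure_UNION_le) auto
  also have "\<dots> \<le> (\<Sum>e\<in>E. ?\<mu> (cball (0::real^'n) (2 * R)))"
    using B unfolding sum_distrib_left by (intro sum_mono) auto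
  also have "\<dots> \<le> 2 * ?d * ?\<mu> (cball (0::real^'n) (2 * R))"
    using E(2) by (auto intro!: mult_right_mono simp flip: of_nat_mult)
  also have "\<dots> \<le> J * (c / 2)" using Jc by (simp add: mult.commute)
  finally have bad: "?\<mu> (\<Union>e\<in>E. B e) \<le> c / 2" using J by simp
  define good where "good = K - (\<Union>e\<in>E. B e)"
  have good_meas: "good \<in> lmeasurable" 
    unfolding good_def using K(2) \<open>(\<Union>e\<in>E. B e) \<in> lmeasurable\<close> by (rule fmeasurable.Diff)
  have "?\<mu> good = ?\<mu> K - ?\<mu> (\<Union>e\<in>E. B e)"
    unfolding good_def using K(2) \<open>(\<Union>e\<in>E. B e) \<in> lmeasurable\<close>
    by (intro measurable_measure_Diff) (auto simp: B_def fmeasurableD)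
  then have good: "c / 2 \<le> ?\<mu> good" using bad c by simp
  have cube: "y \<in> K" if "x \<in> good" "\<And>i. \<bar>y $ i - x $ i\<bar> \<le> \<delta>" for x y
  proof (rule cube_subset_convex[OF K(1) h])
    show "x + h *\<^sub>R axis i 1 \<in> K" "x + h *\<^sub>R (- axis i 1) \<in> K" for i
      using that(1) unfolding good_def B_def E_def by blast+
    show "?d * \<bar>y $ i - x $ i\<bar> \<le> h" for i
      using mult_left_mono[OF that(2)[of i], of ?d] \<delta> by simp
  qed
  \<comment> \<open>The bound on the grid indices costs nothing: mesh times largest index is
    \<open>R\<close>, and \<open>K\<close> lies in the ball of radius \<open>R\<close>.\<close>
  have gridI: "y \<in> G" if y: "y \<in> K" and ex: "\<And>i. \<exists>j::int. y $ i = \<delta> * j" for y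
    unfolding G_def grid_def \<delta>_def[symmetric]
  proof (clarify)
    fix i obtain j :: int where j: "y $ i = \<delta> * j" using ex by blast
    have "\<bar>y $ i\<bar> \<le> R" using component_le_norm_cart[of y i] y K(3) by force
    also have "R = \<delta> * (CARD('n) * J)" using J by (simp add: \<delta>_def)
    finally have "real_of_int \<bar>j\<bar> \<le> real_of_int (int (CARD('n) * J))" using \<delta>(1) by (simp add: j abs_mult)
    then show "\<exists>j. \<bar>j\<bar> \<le> int (CARD('n) * J) \<and> y $ i = \<delta> * real_of_int j"
      using j by (metis of_int_le_iff)
  qed
  have "good \<noteq> {}" using good c by auto
  then obtain x where x: "x \<in> good" by auto
  \<comment> \<open>A corner \<open>u\<close> of the cell of a good point and its neighbours along
    the axes give a nondegenerate simplex of grid points in \<open>K\<close>.\<close>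
  define u :: "real^'n" where "u = (\<chi> i. \<delta> * \<lfloor>x $ i / \<delta>\<rfloor>)"
  have ux: "\<bar>u $ i - x $ i\<bar> \<le> \<delta>" "\<bar>u $ i + \<delta> - x $ i\<bar> \<le> \<delta>" for i
  proof -
    have "\<delta> * \<lfloor>x $ i / \<delta>\<rfloor> \<le> \<delta> * (x $ i / \<delta>)" "\<delta> * (x $ i / \<delta>) \<le> \<delta> * (\<lfloor>x $ i / \<delta>\<rfloor> + 1)"
      using \<delta>(1) of_int_floor_le real_of_int_floor_add_one_ge by (auto intro!: mult_left_mono simp del: times_divide_eq_right)
    then have "\<delta> * \<lfloor>x $ i / \<delta>\<rfloor> \<le> x $ i" "x $ i \<le> \<delta> * (\<lfloor>x $ i / \<delta>\<rfloor> + 1)"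
      using \<delta>(1) by simp_all
    then show "\<bar>u $ i - x $ i\<bar> \<le> \<delta>" "\<bar>u $ i + \<delta> - x $ i\<bar> \<le> \<delta>"
      by (auto simp: u_def algebra_simps abs_le_iff)
  qed
  define z where "z j = u + \<delta> *\<^sub>R axis j 1" for j
  have u: "u \<in> K \<inter> G"
    using cube[OF x ux(1)] gridI[of u] by (auto simp: u_def)
  have z: "z j \<in> K \<inter> G" for j
  proof -
    have "z j \<in> K" using ux by (intro cube[OF x]) (simp add: z_def axis_def)
    moreover have "\<exists>k::int. z j $ i = \<delta> * k" for i
      by (auto simp: z_def u_def axis_def algebra_simps intro: exI[of _ "\<lfloor>x $ i / \<delta>\<rfloor>"] exI[of _ "\<lfloor>x $ i / \<delta>\<rfloor> + 1"])
    ultimately show ?thesis using gridI by blast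
  qed
  have "edge_matrix u z = mat \<delta>"
    by (simp add: edge_matrix_def z_def vec_eq_iff mat_def axis_def)
  then have "det (edge_matrix u z) \<noteq> 0" using \<delta>(1) by (simp add: det_diagonal mat_def)
  then obtain v w where v: "v \<in> K \<inter> G" and w: "range w \<subseteq> K \<inter> G"
    and sub: "K \<inter> G \<subseteq> (\<lambda>t. v + edge_matrix v w *v t) ` cbox (-1) 1"
    using finite_subset_max_simplex_parallelepiped[of "K \<inter> G" u z] u z card_grid(1) unfolding G_def by blast
  let ?P = "(\<lambda>t. v + edge_matrix v w *v t) ` cbox (-1) 1"
  let ?Q = "(\<lambda>t. v + edge_matrix v w *v t) ` cbox 0 (vec (1 / real CARD('n)))"
  have eq: "(\<lambda>t. v + edge_matrix v w *v t) ` S = (+) v ` ((*v) (edge_matrix v w) ` S)" for S by auto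
  have "convex ?P"
    unfolding eq by (intro convex_translation convex_linear_image convex_box) simp
  have "good \<subseteq> ?P"
  proof
    fix x assume x: "x \<in> good"
    show "x \<in> ?P"
    proof (rule cube_corner_grid_hull[OF \<delta>(1) \<open>convex ?P\<close>])
      fix y :: "real^'n" assume y: "\<And>i. \<exists>j::int. y $ i = \<delta> * real_of_int j" "\<And>i. \<bar>y $ i - x $ i\<bar> \<le> \<delta>"
      show "y \<in> ?P" using sub gridI cube[OF x y(2)] y(1) by blast
    qed
  qed
  note good
  also have "?\<mu> good \<le> ?\<mu> ?P"
    by (intro measure_mono_fmeasurable \<open>good \<subseteq> ?P\<close> fmeasurableD[OF good_meas]
        lmeasurable_compact compact_affine_image_cbox_cart)
  finally have "c / 2 \<le> ?\<mu> ?P" .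
  then have "c / (2 ^ (CARD('n) + 1) * ?d ^ CARD('n)) \<le> ?\<mu> ?Q"
    by (simp add: measure_parallelepiped_ratio field_simps)
  moreover have "?Q \<subseteq> K" using parallelepiped_subset_convex[OF K(1), of v w] v w by blast
  ultimately show ?thesis using v w by blast
qed

subsection \<open>Nets and the Danzer set\<close>

text \<open>The number of grid parallelepipeds is polynomial in \<open>2 ^ k\<close>, so its
  logarithm is linear in \<open>k\<close>. The greedy bound multiplies this by the volume of the
  ball, and \<open>C\<close> does not depend on \<open>k\<close>.\<close>

lemma convex_net:
  fixes c :: real
  assumes c: "0 < c"
  shows "\<exists>C. \<forall>k. \<exists>N :: (real^'n) set. finite N \<and>
           card N \<le> C * 2 ^ (k * CARD('n)) * (real k + 1) \<and>
           (\<forall>K. convex K \<and> K \<in> lmeasurable \<and> K \<subseteq> cball 0 (2 ^ k) \<and> c \<le> measure lebesgue K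
              \<longrightarrow> N \<inter> K \<noteq> {})"
proof -
  define d where "d = CARD('n)"
  have d: "0 < d" by (simp add: d_def)
  define V where "V = unit_ball_vol (real d)"
  have V: "0 \<le> V" by (simp add: V_def)
  have ball: "measure lebesgue (cball (0::real^'n) r) = V * r ^ d" if "0 \<le> r" for r
    using that by (simp add: content_cball V_def d_def)
  \<comment> \<open>The volume guaranteed for a parallelepiped inside a convex set of volume
    \<open>c\<close>.\<close>
  define c' where "c' = c / (2 ^ (d + 1) * real d ^ d)"
  have c': "0 < c'" using c d by (simp add: c'_def)
  \<comment> \<open>Chosen so that \<open>J = a * 2 ^ (k * d)\<close> is fine enough at every scale
    \<open>k\<close>.\<close>
  define a where "a = nat \<lceil>4 * d * V * 2 ^ d / c\<rceil> + 1"
  have "4 * d * V * 2 ^ d / c \<le> a" unfolding a_def by linarith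
  then have a: "4 * d * V * 2 ^ d \<le> c * a" "0 < a" using c by (simp_all add: field_simps a_def)
  define b where "b = 2 * d * a + 1"
  define C where "C = V / c' * (d * (d + 1) * (b + d)) + 2"
  have "\<exists>N :: (real^'n) set. finite N \<and> card N \<le> C * 2 ^ (k * d) * (real k + 1) \<and>
           (\<forall>K. convex K \<and> K \<in> lmeasurable \<and> K \<subseteq> cball 0 (2 ^ k) \<and> c \<le> measure lebesgue K
              \<longrightarrow> N \<inter> K \<noteq> {})" for k
  proof -
    define J where "J = a * 2 ^ (k * d)"
    define G :: "(real^'n) set" where "G = grid (2 ^ k / (CARD('n) * J)) (CARD('n) * J)"
    define Q where "Q = (\<lambda>(v :: real^'n, w). (\<lambda>t. v + edge_matrix v w *v t) ` cbox 0 (vec (1 / real CARD('n))))"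
    define P where "P = G \<times> (UNIV \<rightarrow>\<^sub>E G :: ('n \<Rightarrow> real^'n) set)"
    define F where "F = {S \<in> Q ` P. S \<subseteq> cball 0 (2 ^ k) \<and> c' \<le> measure lebesgue S}"
    have G: "finite G" "card G \<le> (2 * (d * J) + 1) ^ d"
      using card_grid unfolding G_def d_def by blast+
    have P: "finite P" "card P = card G ^ (d + 1)"
      using G by (auto simp: P_def card_cartesian_product card_PiE d_def finite_PiE)
    have finF: "finite F" using P(1) by (simp add: F_def)
    have "card F \<le> card (Q ` P)" using P(1) by (auto simp: F_def intro!: card_mono)
    also have "\<dots> \<le> card P" using P(1) by (rule card_image_le)
    also have "\<dots> \<le> ((2 * (d * J) + 1) ^ d) ^ (d + 1)" unfolding P(2) using G(2) by (rule power_mono) simp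
    \<comment> \<open>There are \<open>d + 1\<close> vertices with \<open>d\<close> coordinates
      each, and each coordinate takes at most \<open>b * 2 ^ (k * d)\<close> values.\<close>
    also have "\<dots> \<le> (b * 2 ^ (k * d)) ^ (d * (d + 1))"
      unfolding power_mult[of "b * 2 ^ (k * d)" d "d + 1"]
      by (intro power_mono) (auto simp: b_def J_def algebra_simps)
    finally have "real (card F) \<le> real ((b * 2 ^ (k * d)) ^ (d * (d + 1)))" by (rule of_nat_mono)
    then have cardF: "real (card F) \<le> (real b * 2 ^ (k * d)) ^ (d * (d + 1))" by simp
    have b: "1 \<le> real b" by (simp add: b_def)
    define L where "L = real (d * (d + 1)) * ((real b + d) * (real k + 1))"
    have L0: "0 \<le> L" by (simp add: L_def)
    have L: "ln (card F) \<le> L"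
    proof (cases "card F = 0")
      case False
      have "ln (card F) \<le> ln ((real b * 2 ^ (k * d)) ^ (d * (d + 1)))"
        using cardF False by (intro ln_mono) auto
      also have "\<dots> = real (d * (d + 1)) * (ln b + real (k * d) * ln 2)"
        using b by (simp add: ln_realpow ln_mult del: of_nat_mult of_nat_add)
      also have "\<dots> \<le> L"
        unfolding L_def
      proof (intro mult_left_mono)
        have "ln b \<le> real b" using b ln_le_minus_one[of "real b"] by simp
        moreover have "real (k * d) * ln 2 \<le> real (k * d) * 1"
          using ln_2_less_1 by (intro mult_left_mono) auto
        ultimately have "ln b + real (k * d) * ln 2 \<le> real b + real k * d" by simp
        also have "\<dots> \<le> (real b + d) * (real k + 1)" by (simp add: algebra_simps)
        finally show "ln b + real (k * d) * ln 2 \<le> (real b + d) * (real k + 1)" .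
      qed simp
      finally show ?thesis .
    qed (use L0 in simp)
    have "S \<in> sets lebesgue \<and> S \<subseteq> cball 0 (2 ^ k) \<and> c' \<le> measure lebesgue S" if "S \<in> F" for S
    proof -
      have "compact S" using that by (auto simp: F_def Q_def intro: compact_affine_image_cbox_cart)
      then show ?thesis using that lmeasurable_compact by (auto simp: F_def dest: fmeasurableD)
    qed
    from small_hitting_set[OF lmeasurable_cball finF c' this L L0]
    obtain N where N: "finite N" "card N \<le> measure lebesgue (cball (0::real^'n) (2 ^ k)) / c' * L + 2"
      "\<forall>S\<in>F. N \<inter> S \<noteq> {}" by blast
    \<comment> \<open>The additive 2 is absorbed because \<open>2 ^ (k * d) * (real k + 1)\<close>
      is at least 1.\<close>
    have "V * (2 ^ k) ^ d / c' * L + 2 \<le> V * 2 ^ (k * d) / c' * L + 2 * (2 ^ (k * d) * (real k + 1))"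
      using mult_mono[of 1 "2 ^ (k * d)" 1 "real k + 1"] by (simp add: power_mult)
    also have "\<dots> = C * 2 ^ (k * d) * (real k + 1)"
      by (simp add: C_def L_def algebra_simps add_divide_distrib)
    finally have "card N \<le> C * 2 ^ (k * d) * (real k + 1)"
      using N(2) ball[of "2 ^ k"] by simp
    moreover have "N \<inter> K \<noteq> {}"
      if K: "convex K" "K \<in> lmeasurable" "K \<subseteq> cball 0 (2 ^ k)" "c \<le> measure lebesgue K" for K
    proof -
      have "4 * d * V * 2 ^ d * 2 ^ (k * d) \<le> c * a * 2 ^ (k * d)" using a(1) by (intro mult_right_mono) auto
      then have "4 * CARD('n) * measure lebesgue (cball (0::real^'n) (2 * 2 ^ k)) \<le> c * J"
        using ball[of "2 * 2 ^ k"] by (simp add: J_def d_def power_mult_distrib power_mult mult_ac)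
      then obtain v w where v: "v \<in> G" and w: "range w \<subseteq> G"
        and Q: "Q (v, w) \<subseteq> K" "c' \<le> measure lebesgue (Q (v, w))"
        using convex_contains_grid_parallelepiped[OF K(1-3) _ _ c K(4), of J] a(2)
        unfolding G_def Q_def c'_def d_def J_def by auto
      have "(v, w) \<in> P" using v w by (auto simp: P_def)
      then have "Q (v, w) \<in> F" using Q K(3) by (auto simp: F_def)
      then show ?thesis using N(3) Q(1) by blast
    qed
    ultimately show ?thesis using N(1) by blast
  qed
  then show ?thesis unfolding d_def by blast
qed

section \<open>Dyadic annuli and growth\<close>

lemma dyadic_bracket:
  fixes x :: real
  assumes "1 \<le> x"
  obtains m where "2 ^ m \<le> x" "x < 2 ^ (m + 1)"
proof -
  obtain n where n: "x < 2 ^ n" using real_arch_pow[of 2 x] by auto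
  define l where "l = (LEAST n. x < 2 ^ n)"
  have l: "x < 2 ^ l" unfolding l_def using n by (rule LeastI)
  then have "l \<noteq> 0" using assms by (intro notI) simp
  then obtain m where m: "l = Suc m" by (cases l) auto
  have "\<not> x < 2 ^ m" by (rule not_less_Least) (simp add: m flip: l_def)
  then show thesis using that[of m] l m by simp
qed

text \<open>Truncation to a ball handles unbounded \<open>K\<close> and keeps more than half of the
  volume; the contraction by \<open>1 / 4\<close> costs \<open>4 ^ DIM('a)\<close>. The summand 1 in
  the norm condition lets \<open>k = 0\<close> serve all small sets.\<close>

lemma convex_piece_in_dyadic_annulus:
  fixes K :: "'a::euclidean_space set"
  assumes K: "convex K" "emeasure lebesgue K = 1"
  obtains k K' where "convex K'" "K' \<in> lmeasurable" "K' \<subseteq> K" "K' \<subseteq> cball 0 (2 ^ k)"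
    "\<And>y. y \<in> K' \<Longrightarrow> 2 ^ k \<le> 8 * norm y + 1" "1 / (2 * 4 ^ DIM('a)) \<le> measure lebesgue K'"
proof -
  \<comment> \<open>Sets that are not measurable have \<open>emeasure\<close> 0.\<close>
  have sets: "K \<in> sets lebesgue" using K(2) emeasure_notin_sets by force
  have UN: "(\<Union>n. K \<inter> cball 0 (real n)) = K"
    by (auto simp: real_arch_simple)
  have "(\<lambda>n. measure lebesgue (K \<inter> cball 0 (real n))) \<longlonglongrightarrow> measure lebesgue (\<Union>n. K \<inter> cball 0 (real n))"
  proof (rule Lim_measure_incseq)
    show "incseq (\<lambda>n. K \<inter> cball 0 (real n))" by (force simp: incseq_def)
  qed (use sets K(2) UN in auto)
  moreover have "measure lebesgue K = 1" using K(2) by (simp add: measure_def)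
  ultimately have "\<forall>\<^sub>F n in sequentially. 1 / 2 < measure lebesgue (K \<inter> cball 0 (real n))"
    unfolding UN by (intro order_tendstoD(1)) auto
  then obtain n where n: "1 / 2 < measure lebesgue (K \<inter> cball 0 (real n))"
    by (auto simp: eventually_sequentially)
  define K1 where "K1 = K \<inter> cball 0 (real n)"
  have K1: "convex K1" "bounded K1" "1 / 2 < measure lebesgue K1"
    using K(1) n by (auto simp: K1_def convex_Int)
  have ne: "K1 \<noteq> {}" using K1(3) by auto
  have bdd: "bdd_above (norm ` K1)"
    by (intro bdd_aboveI[of _ "real n"]) (auto simp: K1_def)
  define s where "s = Sup (norm ` K1)"
  have le: "norm y \<le> s" if "y \<in> K1" for y
    unfolding s_def using bdd that by (intro cSup_upper) auto
  have s: "0 < s"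
  proof (rule ccontr)
    assume "\<not> 0 < s"
    then have "norm y \<le> 0" if "y \<in> K1" for y using le[OF that] by linarith
    then have "K1 \<subseteq> {0}" by auto
    then have "negligible K1" by (meson negligible_sing negligible_subset)
    then show False using K1(3) by (simp add: negligible_imp_measure0)
  qed
  \<comment> \<open>Any norm above \<open>2 / 3 * s\<close> would do:
    \<open>3 / 4 * norm x - s / 4\<close> must be at least \<open>s / 4\<close>.\<close>
  then obtain x where x: "x \<in> K1" "7 / 8 * s < norm x"
    using less_cSup_iff[of "norm ` K1" "7 / 8 * s"] ne bdd unfolding s_def by auto
  define K' where "K' = (\<lambda>y. (1 / 4) *\<^sub>R y + (3 / 4) *\<^sub>R x) ` K1"
  have convex: "convex K'"
    unfolding K'_def using convex_affinity[OF K1(1), of "(3 / 4) *\<^sub>R x" "1 / 4"] by (simp add: add.commute)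
  have sub: "K' \<subseteq> K1"
    unfolding K'_def using convexD[OF K1(1) _ x(1), of _ "1 / 4" "3 / 4"] by auto
  have lower: "s / 4 \<le> norm y" if y: "y \<in> K'" for y
  proof -
    obtain z where z: "z \<in> K1" "y = (1 / 4) *\<^sub>R z + (3 / 4) *\<^sub>R x" using y unfolding K'_def by blast
    have "norm ((3 / 4) *\<^sub>R x) - norm (- ((1 / 4) *\<^sub>R z)) \<le> norm ((3 / 4) *\<^sub>R x - (- ((1 / 4) *\<^sub>R z)))"
      by (rule norm_triangle_ineq2)
    then have "3 / 4 * norm x - 1 / 4 * norm z \<le> norm y" by (simp add: z(2) add.commute)
    then show ?thesis using le[OF z(1)] x(2) s by linarith
  qed
  have "1 / 4 ^ DIM('a) * (1 / 2) \<le> 1 / 4 ^ DIM('a) * measure lebesgue K1"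
    using K1(3) by (intro mult_left_mono) auto
  then have meas: "1 / (2 * 4 ^ DIM('a)) \<le> measure lebesgue K'"
    unfolding K'_def measure_lebesgue_affine by (simp add: power_divide)
  obtain k where k: "s \<le> 2 ^ k" "\<And>y. y \<in> K' \<Longrightarrow> 2 ^ k \<le> 8 * norm y + 1"
  proof (cases "s \<le> 1")
    case True
    then show ?thesis by (intro that[of 0]) auto
  next
    case False
    then obtain m where m: "2 ^ m \<le> s" "s < 2 ^ (m + 1)" using dyadic_bracket[of s] by auto
    have "2 ^ (m + 1) \<le> 8 * norm y + 1" if "y \<in> K'" for y
      using lower[OF that] m(1) by simp
    then show ?thesis using m(2) by (intro that[of "m + 1"]) auto
  qed
  show ?thesis
  proof (rule that[OF convex _ _ _ k(2) meas])
    show "K' \<in> lmeasurable" using convex K1(2) sub by (intro measurable_convex) (auto intro: bounded_subset)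
    show "K' \<subseteq> K" using sub by (auto simp: K1_def)
    show "K' \<subseteq> cball 0 (2 ^ k)" using sub le k(1) by force
  qed
qed

lemma sum_power_le_twice_last:
  fixes q :: real
  assumes "2 \<le> q"
  shows "(\<Sum>k\<le>m. q ^ k) \<le> 2 * q ^ m"
proof (induction m)
  case (Suc m)
  have "2 * q ^ m \<le> q * q ^ m" using assms by (intro mult_right_mono) auto
  then show ?case using Suc by simp
qed simp

theorem theorem1p6:
  shows "\<exists>Y :: (real ^ 'd::finite) set.
           danzer_set Y \<and> has_growth_rate Y (\<lambda>T. T ^ CARD('d) * ln T)"
proof -
  define d where "d = CARD('d)"
  have d: "1 \<le> d" by (simp add: d_def Suc_le_eq)
  obtain C where "\<forall>k. \<exists>N :: (real^'d) set. finite N \<and>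
           card N \<le> C * 2 ^ (k * d) * (real k + 1) \<and>
           (\<forall>K. convex K \<and> K \<in> lmeasurable \<and> K \<subseteq> cball 0 (2 ^ k) \<and> 1 / (2 * 4 ^ d) \<le> measure lebesgue K
              \<longrightarrow> N \<inter> K \<noteq> {})"
    using convex_net[where 'n = 'd, of "1 / (2 * 4 ^ d)"] unfolding d_def by auto
  then obtain N :: "nat \<Rightarrow> (real^'d) set" where finN: "\<And>k. finite (N k)"
    and cardN: "\<And>k. card (N k) \<le> C * 2 ^ (k * d) * (real k + 1)"
    and hit: "\<And>k K. convex K \<Longrightarrow> K \<in> lmeasurable \<Longrightarrow> K \<subseteq> cball 0 (2 ^ k) \<Longrightarrow>
      1 / (2 * 4 ^ d) \<le> measure lebesgue K \<Longrightarrow> N k \<inter> K \<noteq> {}"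
    by metis
  have C: "0 \<le> C" using order_trans[OF of_nat_0_le_iff cardN[of 0]] by simp
  \<comment> \<open>Only points of \<open>N k\<close> at norm at least
    \<open>(2 ^ k - 1) / 8\<close> are kept, so a ball meets finitely many of the nets, while every
    piece \<open>K'\<close> found at scale \<open>k\<close> lies in the kept region.\<close>
  define Y where "Y = {y. \<exists>k. y \<in> N k \<and> 2 ^ k \<le> 8 * norm y + 1}"
  have danzer: "danzer_set Y"
    unfolding danzer_set_def
  proof clarify
    fix K :: "(real^'d) set"
    assume K: "convex K" "emeasure lebesgue K = 1" "Y \<inter> K = {}"
    obtain k K' where K': "convex K'" "K' \<in> lmeasurable" "K' \<subseteq> K" "K' \<subseteq> cball 0 (2 ^ k)"
      "\<And>y. y \<in> K' \<Longrightarrow> 2 ^ k \<le> 8 * norm y + 1" "1 / (2 * 4 ^ DIM(real^'d)) \<le> measure lebesgue K'"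
      by (rule convex_piece_in_dyadic_annulus[OF K(1,2)]) (rule that)
    then obtain y where y: "y \<in> N k" "y \<in> K'" using hit[of K' k] by (auto simp: d_def)
    then have "y \<in> Y" using K'(5) unfolding Y_def by blast
    then show False using y(2) K'(3) K(3) by blast
  qed
  have sub: "Y \<inter> ball 0 T \<subseteq> (\<Union>k\<le>m. N k)" if "8 * T + 1 < 2 ^ (m + 1)" for T m
  proof
    fix y assume y: "y \<in> Y \<inter> ball 0 T"
    then obtain k where k: "y \<in> N k" "2 ^ k \<le> 8 * norm y + 1" by (auto simp: Y_def)
    have "(2::real) ^ k < 2 ^ (m + 1)" using k(2) y that by simp
    then have "k < m + 1" by (rule power_less_imp_less_exp[rotated]) simp
    then have "k \<le> m" by simp
    then show "y \<in> (\<Union>k\<le>m. N k)" using k(1) by blast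
  qed
  have "has_growth_rate Y (\<lambda>T. T ^ d * ln T)"
    unfolding has_growth_rate_def
  proof (intro conjI allI)
    fix T :: real
    obtain n where n: "8 * T + 1 < 2 ^ n" using real_arch_pow[of 2 "8 * T + 1"] by auto
    then have "8 * T + 1 < 2 ^ (n + 1)" by (rule less_le_trans) simp
    from sub[OF this] show "finite (Y \<inter> ball 0 T)"
      by (rule finite_subset) (use finN in auto)
  next
    \<comment> \<open>From 9 on, \<open>8 * T + 1\<close> is at most \<open>9 * T\<close>,
      \<open>ln (9 * T)\<close> is at most \<open>2 * ln T\<close>, and \<open>ln T\<close> is at
      least 1.\<close>
    have "card (Y \<inter> ball 0 T) \<le> (8 * C * 9 ^ d) * (T ^ d * ln T)" if T: "9 \<le> T" for T :: real
    proof -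
      obtain m where m: "2 ^ m \<le> 9 * T" "9 * T < 2 ^ (m + 1)"
        using dyadic_bracket[of "9 * T"] T by auto
      have "card (Y \<inter> ball 0 T) \<le> card (\<Union>k\<le>m. N k)"
        using T m(2) finN by (intro card_mono sub) auto
      also have "\<dots> \<le> (\<Sum>k\<le>m. card (N k))" by (rule card_UN_le) simp
      finally have "real (card (Y \<inter> ball 0 T)) \<le> (\<Sum>k\<le>m. real (card (N k)))"
        by (simp flip: of_nat_sum)
      also have "\<dots> \<le> (\<Sum>k\<le>m. C * (real m + 1) * (2 ^ d) ^ k)"
      proof (rule sum_mono)
        fix k assume "k \<in> {..m}"
        then have "C * 2 ^ (k * d) * (real k + 1) \<le> C * 2 ^ (k * d) * (real m + 1)"
          using C by (intro mult_left_mono) auto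
        then show "real (card (N k)) \<le> C * (real m + 1) * (2 ^ d) ^ k"
          using cardN[of k] by (simp add: mult_ac flip: power_mult)
      qed
      \<comment> \<open>The ratio \<open>2 ^ d\<close> is at least 2, so the last term dominates the
        geometric sum and only one logarithmic factor remains.\<close>
      also have "\<dots> \<le> C * (real m + 1) * (2 * (2 ^ d) ^ m)"
        unfolding sum_distrib_left[symmetric] using C d power_increasing[of 1 d "2::real"]
        by (intro mult_left_mono sum_power_le_twice_last) auto
      also have "\<dots> = 2 * C * ((real m + 1) * (2 ^ m) ^ d)"
        by (simp add: mult_ac flip: power_mult)
      also have "\<dots> \<le> 2 * C * ((4 * ln T) * (9 * T) ^ d)"
      proof (intro mult_left_mono mult_mono power_mono)
        have "ln (2 ^ m) \<le> ln (9 * T)" using m(1) T by (intro ln_mono) auto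
        also have "\<dots> \<le> 2 * ln T" using T by (simp add: ln_mult)
        finally have "real m * ln 2 \<le> 2 * ln T" by (simp add: ln_realpow)
        moreover have "real m * (2 / 3) \<le> real m * ln 2"
          \<comment> \<open>With \<open>ln 2\<close> at least \<open>2 / 3\<close>, \<open>m\<close>
            is at most \<open>3 * ln T\<close>; the remaining 1 costs another
            \<open>ln T\<close>.\<close>
          using ln2_ge_two_thirds by (intro mult_left_mono) auto
        moreover have "1 \<le> ln T" using T exp_le by (subst ln_ge_iff) auto
        ultimately show "real m + 1 \<le> 4 * ln T" by simp
      qed (use C T m in auto)
      finally show ?thesis by (simp add: power_mult_distrib mult_ac)
    qed
    then show "(\<lambda>T. real (card (Y \<inter> ball 0 T))) \<in> O(\<lambda>T. T ^ d * ln T)"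
      by (intro bigoI[of _ "8 * C * 9 ^ d"] eventually_mono[OF eventually_ge_at_top[of 9]]) auto
  qed
  with danzer show ?thesis unfolding d_def by blast
qed

end
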